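(* Let $P$ be a finite, graded, bounded poset of rank $n \geq 1$. Then $$\mathrm{ex}\Psi_P(y,\mathbf{a},\mathbf{b}) = \omega\big(\Psi_P(\mathbf{a},\mathbf{b})\big) \quad\text{and}\quad \mathrm{ex}\widetilde{\Psi}_P(y,\mathbf{a},\mathbf{b}) = (1+y)\cdot \omega\big(\widetilde{\Psi}_P(\mathbf{a},\mathbf{b})\big),$$ where $\omega$ is the transformation that replaces all occurrences of $\mathbf{a}\mathbf{b}$ with $(1+y)\mathbf{a}\mathbf{b} + (y+y^2)\mathbf{b}\mathbf{a}$ and then simultaneously replaces all remaining occurrences of $\mathbf{a}$ with $\mathbf{a}+y\mathbf{b}$ and of $\mathbf{b}$ with $\mathbf{b}+y\mathbf{a}$.
   Context: A finite, graded, bounded poset $P$ of rank $n$ is a finite poset with a unique minimum element $\hat 0$ and a unique maximum element $\hat 1$ of rank $n$, where for every $w \in P$ all maximal chains from $\hat 0$ to $w$ have the same length $\mathrm{rk}(w)$. The Möbius function is given by $\mu(w,w)=1$ for all $w\in P$ and $\mu(u,w) = -\sum_{u\le v<w}\mu(u,v)$ for $u<w$. The Poincaré polynomial is $\mathrm{Poin}_P(y)=\sum_{w\in P}\mu(\hat 0,w)(-y)^{\mathrm{rk}(w)}$. Each interval $[u,w]\subseteq P$ is itself a finite, graded, bounded poset (with its own rank function $v \mapsto \mathrm{rk}(v)-\mathrm{rk}(u)$), so $\mathrm{Poin}_{[u,w]}(y)$ is defined. Chains are sets of pairwise comparable elements $\mathcal{C}=\{\mathcal{C}_1<\dots<\mathcal{C}_k<\mathcal{C}_{k+1}\}$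 in $P$ (not necessarily maximal, $k \geq 0$), always assumed to end in $\mathcal{C}_{k+1}=\hat 1$. Put $\mathrm{Poin}_{P,\mathcal{C}}(y)=\prod_{i=1}^k \mathrm{Poin}_{[\mathcal{C}_i,\mathcal{C}_{i+1}]}(y)$. Let $\mathbb{Z}[y]\langle \mathbf{a},\mathbf{b}\rangle$ be the polynomial ring in two noncommuting variables $\mathbf{a},\mathbf{b}$ with coefficients in $\mathbb{Z}[y]$ ($y$ commutes with everything). For $S\subseteq\{0,\dots,n-1\}$ let $\mathsf{wt}_S(\mathbf{a},\mathbf{b})=w_0\cdots w_{n-1}$ with $w_k=\mathbf{b}$ if $k\in S$ and $w_k=\mathbf{a}-\mathbf{b}$ if $k\notin S$; for a chain $\mathcal{C}$ let $\mathsf{wt}_{\mathcal{C}}=\mathsf{wt}_{\{\mathrm{rk}(\mathcal{C}_1),\dots,\mathrm{rk}(\mathcal{C}_k)\}}$. The extended $\mathbf{ab}$-index is $\mathrm{ex}\Psi_P(y,\mathbf{a},\mathbf{b})=\sum_{\mathcal{C}}\mathrm{Poin}_{P,\mathcal{C}}(y)\cdot\mathsf{wt}_{\mathcal{C}}(\mathbf{a},\mathbf{b})$, and the $\mathbf{ab}$-index is $\Psi_P(\mathbf{a},\mathbf{b})=\sum_{\mathcal{C}}\mathsf{wt}_{\mathcal{C}}(\mathbf{a},\mathbf{b}) = \mathrm{ex}\Psi_P(0,\mathbf{a},\mathbf{b})$, both sums over all chains $\mathcal{C}=\{\mathcal{C}_1<\dots<\mathcal{C}_{k+1}=\hat 1\}$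 in $P$. Let $\iota$ be the linear map removing the initial letter from every $\mathbf{ab}$-monomial, and set $\mathrm{ex}\widetilde{\Psi}_P=\iota(\mathrm{ex}\Psi_P)$ and $\widetilde{\Psi}_P=\iota(\Psi_P)$. The transformation $\omega$ is applied to each monomial in $\mathbf{a},\mathbf{b}$ and extended linearly to $\mathbb{Z}\langle\mathbf{a},\mathbf{b}\rangle$, with values in $\mathbb{Z}[y]\langle\mathbf{a},\mathbf{b}\rangle$ (the replacements act on the letters of the original monomial, not on letters produced by an earlier replacement; in particular $\omega(1)=1$). *)

theory Defs
  imports
    "HOL-Library.Poly_Mapping"
    "HOL-Computational_Algebra.Polynomial"
begin

section \<open>Finite graded bounded posets\<close>

text \<open>
  A poset is a set \<open>P\<close> of elements of a type of class \<^class>\<open>order\<close>, with the induced order.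
  An interval of \<open>P\<close> is the poset \<open>P \<inter> {u..w}\<close>.
\<close>

definition bottom :: "'a::order set \<Rightarrow> 'a" where
  "bottom P = (LEAST x. x \<in> P)"

definition top_elem :: "'a::order set \<Rightarrow> 'a" where
  "top_elem P = (GREATEST x. x \<in> P)"

definition maxchain_to :: "'a::order set \<Rightarrow> 'a \<Rightarrow> 'a set \<Rightarrow> bool" where
  "maxchain_to P w C \<longleftrightarrow> pred_on.maxchain (P \<inter> {bottom P..w}) (\<le>) C"

text \<open>The length of a chain is its number of elements minus one.\<close>

definition graded :: "'a::order set \<Rightarrow> bool" where
  "graded P \<longleftrightarrow> (\<forall>w\<in>P. \<forall>C D. maxchain_to P w C \<longrightarrow> maxchain_to P w D \<longrightarrow> card C - 1 = card D - 1)"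

definition rk :: "'a::order set \<Rightarrow> 'a \<Rightarrow> nat" where
  "rk P w = (THE k. \<exists>C. maxchain_to P w C \<and> k = card C - 1)"

definition poset_rank :: "'a::order set \<Rightarrow> nat" where
  "poset_rank P = rk P (top_elem P)"

definition finite_graded_bounded_poset :: "'a::order set \<Rightarrow> bool" where
  "finite_graded_bounded_poset P \<longleftrightarrow>
     finite P \<and> (\<exists>z\<in>P. \<forall>x\<in>P. z \<le> x) \<and> (\<exists>t\<in>P. \<forall>x\<in>P. x \<le> t) \<and> graded P"

text \<open>
  Only the values for finite \<open>P\<close> and \<open>u \<le> w\<close> in \<open>P\<close> are meaningful; the guard \<open>finite P\<close> is
  there for termination.
\<close>

function mobius :: "'a::order set \<Rightarrow> 'a \<Rightarrow> 'a \<Rightarrow> int" where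
  "mobius P u w =
     (if u = w then 1
      else if finite P \<and> u < w then - (\<Sum>v | v \<in> P \<and> u \<le> v \<and> v < w. mobius P u v)
      else 0)"
  by pat_completeness auto
termination
proof (relation "measure (\<lambda>(P, u, w). card {v \<in> P. v < w})", goal_cases)
  case 1
  show ?case by simp
next
  case (2 P u w v)
  then have "{x \<in> P. x < v} \<subset> {x \<in> P. x < w}" "finite {x \<in> P. x < w}"
    by auto
  then show ?case by (simp add: psubset_card_mono)
qed

declare mobius.simps [simp del]


section \<open>Poincare polynomials and chains\<close>

definition var_y :: "int poly" where
  "var_y = [:0, 1:]"

definition Poin :: "'a::order set \<Rightarrow> int poly" where
  "Poin P = (\<Sum>w\<in>P. of_int (mobius P (bottom P) w) * (- var_y) ^ rk P w)"

definition top_chains :: "'a::order set \<Rightarrow> 'a set set" where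
  "top_chains P = {C. pred_on.chain P (\<le>) C \<and> top_elem P \<in> C}"

definition next_in :: "'a::order set \<Rightarrow> 'a \<Rightarrow> 'a" where
  "next_in C x = (LEAST z. z \<in> C \<and> x < z)"

text \<open>
  For \<open>C = {C\<^sub>1 < \<dots> < C\<^sub>k < C\<^sub>k\<^sub>+\<^sub>1}\<close> in \<^term>\<open>top_chains P\<close>, the set \<^term>\<open>C - {top_elem P}\<close> consists of
  \<open>C\<^sub>1, \<dots>, C\<^sub>k\<close>, and \<^const>\<open>next_in\<close> takes \<open>C\<^sub>i\<close> to \<open>C\<^sub>i\<^sub>+\<^sub>1\<close>.
\<close>

definition Poin_chain :: "'a::order set \<Rightarrow> 'a set \<Rightarrow> int poly" where
  "Poin_chain P C = (\<Prod>x \<in> C - {top_elem P}. Poin (P \<inter> {x..next_in C x}))"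


section \<open>Polynomials in two noncommuting variables\<close>

text \<open>
  The words in the letters \<open>a\<close>, \<open>b\<close> form the free monoid, written additively so that the
  convolution product of \<^typ>\<open>'m \<Rightarrow>\<^sub>0 'c\<close> is the product of noncommutative polynomials
  (with coefficients in \<open>'c\<close>, which commute with the variables).
\<close>

datatype letter = Letter_a | Letter_b

datatype ab_word = Word (letters: "letter list")

instantiation ab_word :: monoid_add
begin

definition zero_ab_word :: ab_word where
  "0 = Word []"

definition plus_ab_word :: "ab_word \<Rightarrow> ab_word \<Rightarrow> ab_word" where
  "v + w = Word (letters v @ letters w)"

instance
  by standard (simp_all add: zero_ab_word_def plus_ab_word_def)

end

type_synonym 'c ab_poly = "ab_word \<Rightarrow>\<^sub>0 'c"

definition var_a :: "'c::ring_1 ab_poly" where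
  "var_a = Poly_Mapping.single (Word [Letter_a]) 1"

definition var_b :: "'c::ring_1 ab_poly" where
  "var_b = Poly_Mapping.single (Word [Letter_b]) 1"

definition const :: "'c::ring_1 \<Rightarrow> 'c ab_poly" where
  "const c = Poly_Mapping.single 0 c"

definition wt :: "nat \<Rightarrow> nat set \<Rightarrow> 'c::ring_1 ab_poly" where
  "wt n S = prod_list (map (\<lambda>k. if k \<in> S then var_b else var_a - var_b) [0..<n])"

definition wt_chain :: "'a::order set \<Rightarrow> 'a set \<Rightarrow> 'c::ring_1 ab_poly" where
  "wt_chain P C = wt (poset_rank P) (rk P ` (C - {top_elem P}))"

definition ex_ab_index :: "'a::order set \<Rightarrow> int poly ab_poly" where
  "ex_ab_index P = (\<Sum>C\<in>top_chains P. const (Poin_chain P C) * wt_chain P C)"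

definition ab_index :: "'a::order set \<Rightarrow> int ab_poly" where
  "ab_index P = (\<Sum>C\<in>top_chains P. wt_chain P C)"

text \<open>On the empty word, which has no initial letter, \<open>iota\<close> is the identity.\<close>

definition iota :: "'c::ring_1 ab_poly \<Rightarrow> 'c ab_poly" where
  "iota f = (\<Sum>w\<in>Poly_Mapping.keys f. Poly_Mapping.single (Word (tl (letters w))) (Poly_Mapping.lookup f w))"

text \<open>
  Occurrences of \<open>ab\<close> in a word never overlap, so replacing all of them first and then the
  remaining letters amounts to a single pass from left to right.
\<close>

fun omega_letters :: "letter list \<Rightarrow> int poly ab_poly" where
  "omega_letters [] = 1"
| "omega_letters (Letter_a # Letter_b # ls) =
     (const (1 + var_y) * (var_a * var_b) + const (var_y + var_y ^ 2) * (var_b * var_a)) * omega_letters ls"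
| "omega_letters (Letter_a # ls) = (var_a + const var_y * var_b) * omega_letters ls"
| "omega_letters (Letter_b # ls) = (var_b + const var_y * var_a) * omega_letters ls"

definition omega :: "int ab_poly \<Rightarrow> int poly ab_poly" where
  "omega f = (\<Sum>w\<in>Poly_Mapping.keys f. const (of_int (Poly_Mapping.lookup f w)) * omega_letters (letters w))"

end

theory Submission
  imports Defs
begin

text \<open>
  Put \<open>e = a - b\<close>. A chain contributes the letter \<open>b\<close> at the ranks of its elements below the top
  \<open>1\<close> of \<open>P\<close> and \<open>e\<close> at all other ranks. Let \<open>F(u)\<close> be the weighted sum over the chains with least
  element \<open>u \<noteq> 1\<close>, starting at the rank of \<open>u\<close> and with the initial \<open>b\<close> removed, and let
  \<open>F(1) = 0\<close>. Splitting off the least element of a chain gives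
  \<open>F(u) = (\<Sum>w > u. m(u,w) e^(rk w - rk u - 1) ([w = 1] + b F(w)))\<close>,
  where \<open>m(u,w)\<close> is \<open>1\<close> for the ab-index and the Poincare polynomial of \<open>[u,w]\<close> for the extended
  one. The index is the sum of \<open>e^(rk w) ([w = 1] + b F(w))\<close> over all \<open>w\<close>. Since \<open>iota\<close> maps
  every multiple \<open>e f\<close> to \<open>0\<close>, it maps the index to the value of \<open>F\<close> at the bottom.

  Write \<open>F\<close> for the unweighted sums and \<open>F'\<close> for the ones weighted by Poincare polynomials. The
  point of the proof is that \<open>E = F'\<close> and \<open>E = (1 + y) \<omega>(F)\<close> solve the same system of linear
  equations, one for each \<open>u\<close>, where \<open>k\<close> stands for \<open>rk w - rk u\<close>:
  \<open>(\<Sum>w \<ge> u. e^k ([w = 1] + b E(w))) = (\<Sum>w \<ge> u. (- y)^k e^k ([w = 1] + a E(w)))\<close>.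
  Solutions are called balanced. Once the values above \<open>u\<close> are known, the equation at \<open>u\<close> determines
  \<open>a E(u) - b E(u)\<close> and hence \<open>E(u)\<close>, so there is only one solution (\<open>balanced_unique\<close>).

  That \<open>F'\<close> is balanced (\<open>balanced_Poincare\<close>) is Moebius inversion: in the incidence algebra,
  the intervals' Poincare polynomials are the inverse of \<open>(- y)^(rk w - rk u)\<close> times the zeta
  function.

  That \<open>(1 + y) \<omega>(F)\<close> is balanced (\<open>balanced_omega\<close>) depends on how far \<open>\<omega>\<close> is from being
  multiplicative. By its definition, \<open>\<omega>(a b f) = (a + y b) \<omega>(b f) - y e^2 \<omega>(f)\<close>. Thus \<open>\<omega>\<close>
  satisfies the recurrence \<open>\<omega>(e e f) = (1 - y) e \<omega>(e f) + y e^2 \<omega>(f)\<close>, whose characteristic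
  polynomial has the roots \<open>1\<close> and \<open>- y\<close>. Solving it yields
  \<open>\<omega>(e^k b f) = e^k b \<omega>(f) + y (- y)^k e^k a \<omega>(f)\<close> and a similar formula for \<open>\<omega>(e^k)\<close>
  (\<open>omega_var_e_power_mult\<close>). The two summands are the terms of the two sides of the balance
  equation.

  Uniqueness now gives \<open>F' = (1 + y) \<omega>(F)\<close>, whose value at the bottom is the second claim.
  For the first claim, apply the same formula for \<open>\<omega>\<close> to the terms of the ab-index: by the balance
  equation at the bottom, the second summands add up to \<open>y\<close> times the sum of the first ones, which
  is the extended ab-index. So \<open>1 + y\<close> times the claim holds, and \<open>1 + y\<close> can be cancelled.
\<close>

section \<open>Coefficients of noncommutative polynomials and linearity of iota and omega\<close>

lemma poly_mapping_add_induct [case_names zero single add]: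
  assumes "Q 0" and "\<And>w c. Q (Poly_Mapping.single w c)"
    and "\<And>f g. Q f \<Longrightarrow> Q g \<Longrightarrow> Q (f + g)"
  shows "Q (f :: 'k \<Rightarrow>\<^sub>0 'c::comm_monoid_add)"
proof -
  have sum_rule: "Q (\<Sum>w\<in>A. Poly_Mapping.single w (Poly_Mapping.lookup f w))" if "finite A" for A
    using that by (induction A rule: finite_induct) (auto intro: assms)
  have "f = (\<Sum>w\<in>Poly_Mapping.keys f. Poly_Mapping.single w (Poly_Mapping.lookup f w))"
    by (rule poly_mapping_eqI)
       (auto simp: lookup_sum lookup_single when_def sum.delta in_keys_iff)
  then show ?thesis
    using sum_rule [of "Poly_Mapping.keys f"] by simp
qed

text \<open>
  Both \<open>iota\<close> and \<open>omega\<close> are sums over the support of a polynomial of a term that is additive in the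
  coefficient. This is the reason why they are additive, although the support of a sum
  depends on cancellation.
\<close>

lemma sum_keys_add:
  assumes zero: "\<And>w. h w 0 = (0::'b::comm_monoid_add)"
    and add: "\<And>w c d. h w (c + d) = h w c + h w d"
  shows "(\<Sum>w\<in>Poly_Mapping.keys (f + g). h w (Poly_Mapping.lookup (f + g) w)) =
         (\<Sum>w\<in>Poly_Mapping.keys f. h w (Poly_Mapping.lookup f w)) +
         (\<Sum>w\<in>Poly_Mapping.keys g. h w (Poly_Mapping.lookup g w))"
proof -
  let ?A = "Poly_Mapping.keys f \<union> Poly_Mapping.keys g"
  have ext: "(\<Sum>w\<in>Poly_Mapping.keys p. h w (Poly_Mapping.lookup p w)) =
      (\<Sum>w\<in>?A. h w (Poly_Mapping.lookup p w))" if "Poly_Mapping.keys p \<subseteq> ?A" for p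
    by (rule sum.mono_neutral_left) (use that in \<open>auto simp: in_keys_iff zero\<close>)
  show ?thesis
    by (subst (1 2 3) ext) (use keys_add [of f g] in \<open>auto simp: lookup_add add sum.distrib\<close>)
qed

lemma const_0 [simp]: "const 0 = 0"
  by (simp add: const_def)

lemma const_1 [simp]: "const 1 = 1"
  by (simp add: const_def)

lemma const_add: "const (c + d) = const c + const d"
  by (simp add: const_def single_add)

lemma const_minus: "const (- c) = - const c"
  by (simp add: const_def single_uminus)

lemma const_mult: "const (c * d) = const c * const d"
  by (simp add: const_def mult_single)

lemma const_sum: "const (sum f A) = (\<Sum>x\<in>A. const (f x))"
  by (induction A rule: infinite_finite_induct) (simp_all add: const_add)

lemma lookup_const_mult:
  "Poly_Mapping.lookup (const c * f) w = c * Poly_Mapping.lookup f w"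
proof (induction f rule: poly_mapping_add_induct)
  case (single v d)
  then show ?case by (auto simp: const_def mult_single lookup_single when_def)
qed (simp_all add: lookup_add distrib_left)

lemma const_commute:
  fixes c :: "'c::comm_ring_1"
  shows "f * const c = const c * f"
proof (induction f rule: poly_mapping_add_induct)
  case (single v d)
  then show ?case by (simp add: const_def mult_single mult.commute)
qed (simp_all add: distrib_left distrib_right)

lemma const_left_commute:
  fixes c :: "'c::comm_ring_1"
  shows "f * (const c * g) = const c * (f * g)"
  by (metis const_commute mult.assoc)

lemma const_mult_cancel:
  fixes c :: "'c::idom"
  assumes "const c * f = const c * g" and "c \<noteq> 0"
  shows "f = g"
  using assms by (metis lookup_const_mult mult_left_cancel poly_mapping_eqI)

lemma var_mult_single:
  "var_a * Poly_Mapping.single (Word l) c = Poly_Mapping.single (Word (Letter_a # l)) c"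
  "var_b * Poly_Mapping.single (Word l) c = Poly_Mapping.single (Word (Letter_b # l)) c"
  by (simp_all add: var_a_def var_b_def mult_single plus_ab_word_def)

lemma lookup_var_mult:
  "Poly_Mapping.lookup (var_a * f) (Word (Letter_a # l)) = Poly_Mapping.lookup f (Word l)"
  "Poly_Mapping.lookup (var_b * f) (Word (Letter_a # l)) = 0"
proof (induction f rule: poly_mapping_add_induct)
  case (single v d)
  case 1 show ?case by (cases v) (simp add: var_mult_single lookup_single when_def)
next
  case (single v d)
  case 2 show ?case by (cases v) (simp add: var_mult_single lookup_single when_def)
qed (simp_all add: lookup_add distrib_left)

text \<open>
  This is cancellation of \<open>a - b\<close>: no word begins with both letters.
\<close>

lemma var_a_mult_eq_var_b_mult:
  assumes "var_a * f = var_b * f"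
  shows "f = 0"
proof (rule poly_mapping_eqI)
  fix w
  show "Poly_Mapping.lookup f w = Poly_Mapping.lookup 0 w"
    using lookup_var_mult [of f "letters w"] assms by simp
qed

lemma iota_0 [simp]: "iota 0 = 0"
  by (simp add: iota_def)

lemma iota_add: "iota (f + g) = iota f + iota g"
  unfolding iota_def by (rule sum_keys_add) (simp_all add: single_add)

lemma iota_diff: "iota (f - g) = iota f - iota g"
  by (metis add_diff_cancel_right' diff_add_cancel iota_add)

lemma iota_sum: "iota (sum f A) = (\<Sum>x\<in>A. iota (f x))"
  by (induction A rule: infinite_finite_induct) (simp_all add: iota_add)

lemma iota_single:
  "iota (Poly_Mapping.single w c) = Poly_Mapping.single (Word (tl (letters w))) c"
  by (simp add: iota_def)

lemma iota_var_mult [simp]: "iota (var_a * f) = f" "iota (var_b * f) = f"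
proof (induction f rule: poly_mapping_add_induct)
  case (single v d)
  case 1 show ?case by (cases v) (simp add: var_mult_single iota_single)
next
  case (single v d)
  case 2 show ?case by (cases v) (simp add: var_mult_single iota_single)
qed (simp_all add: iota_add distrib_left)

lemma omega_0 [simp]: "omega 0 = 0"
  by (simp add: omega_def)

lemma omega_add: "omega (f + g) = omega f + omega g"
  unfolding omega_def
  by (rule sum_keys_add) (simp_all add: const_add distrib_right)

lemma omega_diff: "omega (f - g) = omega f - omega g"
  by (metis add_diff_cancel_right' diff_add_cancel omega_add)

lemma omega_sum: "omega (sum f A) = (\<Sum>x\<in>A. omega (f x))"
  by (induction A rule: infinite_finite_induct) (simp_all add: omega_add)

lemma omega_single:
  "omega (Poly_Mapping.single w c) = const (of_int c) * omega_letters (letters w)"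
  by (simp add: omega_def)

lemma omega_1 [simp]: "omega 1 = 1"
  using omega_single [of 0 1] by (simp add: zero_ab_word_def [symmetric]) (simp add: zero_ab_word_def)

section \<open>The map omega on powers of a - b\<close>

abbreviation y :: "int poly ab_poly" where
  "y \<equiv> const var_y"

lemma const_merge: "const r * const s = const (r * s)" "const r * (const s * f) = const (r * s) * f"
  by (simp_all add: const_mult mult.assoc)

text \<open>
  Scalars move to the left and merge, so that after distribution two equal noncommutative
  polynomials become literally the same sum of terms.
\<close>

lemmas const_normalize =
  const_commute [of var_a] const_commute [of var_b]
  const_commute [of "omega f" for f] const_commute [of "f ^ k" for f k]
  const_left_commute [of var_a] const_left_commute [of var_b]
  const_left_commute [of "omega f" for f] const_left_commute [of "f ^ k" for f k]
  const_merge const_add const_minus algebra_simps power2_eq_square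

lemma omega_var_b_mult: "omega (var_b * f) = (var_b + y * var_a) * omega f"
proof (induction f rule: poly_mapping_add_induct)
  case (single v d)
  show ?case
    by (cases v) (simp add: var_mult_single omega_single const_left_commute)
qed (simp_all add: omega_add distrib_left)

lemma omega_var_a: "omega var_a = var_a + y * var_b"
  by (simp add: var_a_def omega_single)

lemma omega_var_a_var_a_mult:
  "omega (var_a * (var_a * f)) = (var_a + y * var_b) * omega (var_a * f)"
proof (induction f rule: poly_mapping_add_induct)
  case (single v d)
  show ?case
    by (cases v) (simp add: var_mult_single omega_single const_left_commute)
qed (simp_all add: omega_add distrib_left)

text \<open>
  The defect of multiplicativity of \<open>omega\<close>. A pass from left to right that meets \<open>ab\<close> differs from
  one that treats the two letters separately by
  \<open>(1 + y) (ab + y ba) - (a + y b) (b + y a) = - y (a - b) (a - b)\<close>.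
\<close>

lemma omega_var_a_var_b_mult:
  "omega (var_a * (var_b * f)) =
   (var_a + y * var_b) * omega (var_b * f) - y * (var_a - var_b) * (var_a - var_b) * omega f"
proof (induction f rule: poly_mapping_add_induct)
  case (single v d)
  have "omega (var_a * (var_b * Poly_Mapping.single v d)) =
      (const (1 + var_y) * (var_a * var_b) + const (var_y + var_y ^ 2) * (var_b * var_a)) *
      omega (Poly_Mapping.single v d)"
    by (cases v) (simp add: var_mult_single omega_single const_left_commute)
  then show ?case
    by (simp add: omega_var_b_mult const_normalize)
qed (simp_all add: omega_add distrib_left distrib_right)

abbreviation var_e :: "'c::ring_1 ab_poly" where
  "var_e \<equiv> var_a - var_b"

lemma omega_var_e: "omega var_e = (1 - y) * var_e"
  using omega_var_b_mult [of 1]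
  by (simp add: omega_diff omega_var_a const_normalize)

lemma omega_var_e_var_b_mult:
  "omega (var_e * (var_b * f)) = (1 - y) * var_e * omega (var_b * f) - y * var_e * var_e * omega f"
  by (simp add: left_diff_distrib [of var_a] omega_diff omega_var_a_var_b_mult)
     (simp add: omega_var_b_mult const_normalize)

text \<open>
  Left multiplication by \<open>a - b\<close> is governed by a linear recurrence of order two, because the defect
  looks only two letters ahead. Its characteristic polynomial \<open>x^2 - (1 - y) x - y\<close> is
  \<open>(x - 1) (x + y)\<close>, which explains the two terms in the closed forms below.
\<close>

lemma omega_var_e_var_e_mult:
  "omega (var_e * (var_e * f)) = (1 - y) * var_e * omega (var_e * f) + y * var_e * var_e * omega f"
proof -
  have e_f: "omega (var_e * f) = omega (var_a * f) - omega (var_b * f)"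
    by (simp add: left_diff_distrib omega_diff)
  have "var_e * (var_e * f) = var_a * (var_a * f) - var_a * (var_b * f) - var_b * (var_e * f)"
    by (simp add: algebra_simps)
  then have "omega (var_e * (var_e * f)) = (var_a + y * var_b) * omega (var_a * f)
      - ((var_a + y * var_b) * omega (var_b * f) - y * var_e * var_e * omega f)
      - (var_b + y * var_a) * omega (var_e * f)"
    by (simp only: omega_diff omega_var_a_var_a_mult omega_var_a_var_b_mult omega_var_b_mult)
  then show ?thesis
    unfolding e_f by (simp add: const_normalize)
qed

lemma omega_var_e_power:
  "(1 + y) * omega (var_e ^ k) = var_e ^ k + const (var_y * (- var_y) ^ k) * var_e ^ k"
proof (induction k rule: induct_nat_012)
  case 1
  show ?case by (simp add: omega_var_e const_normalize)
next
  case (ge2 k)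
  have scale: "(1 + y) * ((1 - y) * var_e * f + y * var_e * var_e * g) =
      (1 - y) * var_e * ((1 + y) * f) + y * var_e * var_e * ((1 + y) * g)" for f g
    by (simp add: const_normalize)
  have "(1 + y) * omega (var_e ^ Suc (Suc k)) =
      (1 - y) * var_e * ((1 + y) * omega (var_e ^ Suc k)) + y * var_e * var_e * ((1 + y) * omega (var_e ^ k))"
    using omega_var_e_var_e_mult [of "var_e ^ k"] by (simp only: scale power_Suc)
  also have "\<dots> = var_e ^ Suc (Suc k) + const (var_y * (- var_y) ^ Suc (Suc k)) * var_e ^ Suc (Suc k)"
    unfolding ge2 by (simp add: const_normalize)
  finally show ?case .
qed simp

lemma omega_var_e_power_var_b_mult:
  "omega (var_e ^ k * (var_b * f)) =
   var_e ^ k * (var_b * omega f) + const (var_y * (- var_y) ^ k) * var_e ^ k * (var_a * omega f)"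
proof (induction k rule: induct_nat_012)
  case 0
  show ?case by (simp add: omega_var_b_mult const_normalize)
next
  case 1
  have "omega (var_e * (var_b * f)) =
      (1 - y) * var_e * ((var_b + y * var_a) * omega f) - y * var_e * var_e * omega f"
    by (simp only: omega_var_e_var_b_mult omega_var_b_mult)
  then show ?case by (simp add: const_normalize)
next
  case (ge2 k)
  have "omega (var_e ^ Suc (Suc k) * (var_b * f)) =
      (1 - y) * var_e * omega (var_e ^ Suc k * (var_b * f)) + y * var_e * var_e * omega (var_e ^ k * (var_b * f))"
    using omega_var_e_var_e_mult [of "var_e ^ k * (var_b * f)"] by (simp only: mult.assoc power_Suc)
  also have "\<dots> = var_e ^ Suc (Suc k) * (var_b * omega f)
      + const (var_y * (- var_y) ^ Suc (Suc k)) * var_e ^ Suc (Suc k) * (var_a * omega f)"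
    unfolding ge2 by (simp add: const_normalize)
  finally show ?case .
qed

text \<open>
  The truth value \<open>Q\<close> tells whether the chain element that is reached is the top of the poset, which
  contributes no letter. The factor \<open>1 + y\<close>, the difference of the roots of the recurrence, clears
  the denominator in the closed form for \<open>omega (var_e ^ k)\<close>.
\<close>

lemma omega_var_e_power_mult:
  fixes f :: "int ab_poly"
  defines "g \<equiv> (1 + y) * omega f"
  shows "(1 + y) * omega (var_e ^ k * (of_bool Q + var_b * f)) =
    var_e ^ k * (of_bool Q + var_b * g) +
    const (var_y * (- var_y) ^ k) * (var_e ^ k * (of_bool Q + var_a * g))"
proof -
  have "(1 + y) * omega (var_e ^ k * (var_b * f)) =
      var_e ^ k * (var_b * g) + const (var_y * (- var_y) ^ k) * (var_e ^ k * (var_a * g))"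
    by (simp add: omega_var_e_power_var_b_mult g_def const_normalize)
  moreover have "(1 + y) * omega (var_e ^ k * of_bool Q) =
      var_e ^ k * of_bool Q + const (var_y * (- var_y) ^ k) * (var_e ^ k * of_bool Q)"
    using omega_var_e_power [of k] by (cases Q) (simp_all add: mult.assoc)
  ultimately show ?thesis
    by (simp only: distrib_left omega_add) (simp only: add.assoc add.commute add.left_commute)
qed

section \<open>Rank, Moebius function and Poincare polynomial of intervals\<close>

lemma chain_le_iff:
  "pred_on.chain A (\<le>) C \<longleftrightarrow> C \<subseteq> A \<and> (\<forall>x\<in>C. \<forall>z\<in>C. x \<le> z \<or> z \<le> (x::'a::order))"
  by (auto simp: pred_on.chain_def)

lemma maxchain_le_iff:
  "pred_on.maxchain A (\<le>) C \<longleftrightarrow> pred_on.chain A (\<le>) C \<and>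
     (\<forall>x\<in>A. (\<forall>z\<in>C. x \<le> z \<or> z \<le> (x::'a::order)) \<longrightarrow> x \<in> C)"
  (is "_ \<longleftrightarrow> ?R")
proof
  assume max: "pred_on.maxchain A (\<le>) C"
  have "x \<in> C" if "x \<in> A" "\<forall>z\<in>C. x \<le> z \<or> z \<le> x" for x
  proof (rule ccontr)
    assume "x \<notin> C"
    moreover have "pred_on.chain A (\<le>) (insert x C)"
      using max that by (auto simp: pred_on.maxchain_def chain_le_iff)
    ultimately show False
      using max by (auto simp: pred_on.maxchain_def)
  qed
  then show ?R using max by (auto simp: pred_on.maxchain_def)
next
  assume R: ?R
  show "pred_on.maxchain A (\<le>) C"
    unfolding pred_on.maxchain_def
  proof (intro conjI notI)
    assume "\<exists>S. pred_on.chain A (\<le>) S \<and> C \<subset> S"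
    then obtain S x where "pred_on.chain A (\<le>) S" "C \<subset> S" "x \<in> S" "x \<notin> C"
      by auto
    then have "x \<in> A" "\<forall>z\<in>C. x \<le> z \<or> z \<le> x"
      by (auto simp: chain_le_iff)
    with R \<open>x \<notin> C\<close> show False
      by blast
  qed (use R in simp)
qed

lemma maxchain_mem:
  assumes "pred_on.maxchain A (\<le>) C" "x \<in> A" "\<And>z. z \<in> C \<Longrightarrow> x \<le> z \<or> z \<le> (x::'a::order)"
  shows "x \<in> C"
  using assms unfolding maxchain_le_iff by blast

lemma maxchain_subset: "pred_on.maxchain A R C \<Longrightarrow> C \<subseteq> A"
  by (simp add: pred_on.maxchain_def pred_on.chain_def)

lemma maxchain_interval_endpoints:
  assumes C: "pred_on.maxchain (P \<inter> {u..v}) (\<le>) C" and uv: "u \<in> P" "v \<in> P" "u \<le> (v::'a::order)"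
  shows "u \<in> C" "v \<in> C"
proof -
  have "\<forall>z\<in>C. u \<le> z \<and> z \<le> v"
    using maxchain_subset [OF C] by auto
  then show "u \<in> C" "v \<in> C"
    by (auto intro: maxchain_mem [OF C] simp: uv)
qed

text \<open>
  Rank differences are lengths of maximal chains in intervals: a maximal chain below \<open>u\<close> is
  continued by one above \<open>u\<close>, and nothing can be added to the union, since its new elements would be
  comparable with \<open>u\<close>.
\<close>

lemma maxchain_interval_Un:
  assumes C: "pred_on.maxchain (P \<inter> {z..u}) (\<le>) C" and D: "pred_on.maxchain (P \<inter> {u..v}) (\<le>) D"
    and "z \<in> P" "u \<in> P" "z \<le> u" "u \<le> (v::'a::order)"
  shows "pred_on.maxchain (P \<inter> {z..v}) (\<le>) (C \<union> D)"
proof -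
  have u: "u \<in> C"
    using maxchain_interval_endpoints [OF C] assms by simp
  have sub: "C \<subseteq> P \<inter> {z..u}" "D \<subseteq> P \<inter> {u..v}"
    by (rule maxchain_subset [OF C], rule maxchain_subset [OF D])
  have "pred_on.chain (P \<inter> {z..v}) (\<le>) (C \<union> D)"
    unfolding chain_le_iff
  proof (intro conjI ballI)
    show "C \<union> D \<subseteq> P \<inter> {z..v}"
      using sub assms(5,6) by force
    fix x w
    assume "x \<in> C \<union> D" "w \<in> C \<union> D"
    moreover have "x \<le> w \<or> w \<le> x" if "x \<in> C" "w \<in> C" for x w
      using C that by (auto simp: maxchain_le_iff chain_le_iff)
    moreover have "x \<le> w \<or> w \<le> x" if "x \<in> D" "w \<in> D" for x w
      using D that by (auto simp: maxchain_le_iff chain_le_iff)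
    moreover have "x \<le> w" if "x \<in> C" "w \<in> D" for x w
      using sub that by (meson IntE atLeastAtMost_iff order_trans subsetD)
    ultimately show "x \<le> w \<or> w \<le> x"
      by blast
  qed
  moreover have "x \<in> C \<union> D"
    if x: "x \<in> P \<inter> {z..v}" and comp: "\<forall>w\<in>C \<union> D. x \<le> w \<or> w \<le> x" for x
  proof (cases "x \<le> u")
    case True
    then have "x \<in> C"
      using x comp by (intro maxchain_mem [OF C]) auto
    then show ?thesis by simp
  next
    case False
    then have "x \<in> P \<inter> {u..v}"
      using u x comp by auto
    then have "x \<in> D"
      using comp by (intro maxchain_mem [OF D]) auto
    then show ?thesis by simp
  qed
  ultimately show ?thesis
    unfolding maxchain_le_iff [of _ "C \<union> D"] by (intro conjI ballI impI)
qed

lemma finite_chain_least: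
  assumes "finite C" "C \<noteq> {}" "\<And>x z. x \<in> C \<Longrightarrow> z \<in> C \<Longrightarrow> x \<le> z \<or> z \<le> (x::'a::order)"
  obtains u where "u \<in> C" "\<And>x. x \<in> C \<Longrightarrow> u \<le> x"
proof -
  obtain u where "u \<in> C" "\<forall>x\<in>C. x \<le> u \<longrightarrow> u = x"
    using finite_has_minimal [OF assms(1,2)] by blast
  then show ?thesis
    using assms(3) by (intro that [of u]) auto
qed

locale fgb_poset =
  fixes P :: "'a::order set"
  assumes fgb: "finite_graded_bounded_poset P"
begin

abbreviation zero_P :: 'a ("\<zero>") where "\<zero> \<equiv> bottom P"
abbreviation one_P :: 'a ("\<one>") where "\<one> \<equiv> top_elem P"
abbreviation rank :: "'a \<Rightarrow> nat" where "rank \<equiv> rk P"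

lemma finite_P [simp]: "finite P"
  using fgb by (simp add: finite_graded_bounded_poset_def)

lemma zero_in_P [simp]: "\<zero> \<in> P" and zero_le: "x \<in> P \<Longrightarrow> \<zero> \<le> x"
proof -
  obtain z where z: "z \<in> P" "\<forall>x\<in>P. z \<le> x"
    using fgb by (auto simp: finite_graded_bounded_poset_def)
  then have "\<zero> = z"
    unfolding bottom_def by (intro Least_equality) auto
  with z show "\<zero> \<in> P" "x \<in> P \<Longrightarrow> \<zero> \<le> x" by auto
qed

lemma one_in_P [simp]: "\<one> \<in> P" and le_one: "x \<in> P \<Longrightarrow> x \<le> \<one>"
proof -
  obtain z where z: "z \<in> P" "\<forall>x\<in>P. x \<le> z"
    using fgb by (auto simp: finite_graded_bounded_poset_def)
  then have "\<one> = z"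
    unfolding top_elem_def by (intro Greatest_equality) auto
  with z show "\<one> \<in> P" "x \<in> P \<Longrightarrow> x \<le> \<one>" by auto
qed

lemma rank_eq_card:
  assumes "w \<in> P" "maxchain_to P w C"
  shows "rank w = card C - 1"
  unfolding rk_def
proof (rule the_equality)
  fix k
  assume "\<exists>D. maxchain_to P w D \<and> k = card D - 1"
  then obtain D where "maxchain_to P w D" "k = card D - 1" by blast
  then show "k = card C - 1"
    using fgb assms unfolding finite_graded_bounded_poset_def graded_def by blast
qed (use assms in blast)

lemma rank_add_interval:
  assumes D: "pred_on.maxchain (P \<inter> {u..v}) (\<le>) D" and uv: "u \<in> P" "v \<in> P" "u \<le> v"
  shows "rank v = rank u + (card D - 1)"
proof -
  obtain C where C: "pred_on.maxchain (P \<inter> {\<zero>..u}) (\<le>) C"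
    using pred_on.Hausdorff by blast
  have CD: "pred_on.maxchain (P \<inter> {\<zero>..v}) (\<le>) (C \<union> D)"
    using maxchain_interval_Un [OF C D] uv zero_le by simp
  have sub: "C \<subseteq> P \<inter> {\<zero>..u}" "D \<subseteq> P \<inter> {u..v}"
    by (rule maxchain_subset [OF C], rule maxchain_subset [OF D])
  then have fin: "finite C" "finite D"
    by (meson finite_Int finite_P finite_subset)+
  have u: "u \<in> C" "u \<in> D"
    using maxchain_interval_endpoints [OF C] maxchain_interval_endpoints [OF D] uv zero_le
    by simp_all
  then have "C \<inter> D = {u}"
    using sub by force
  then have "card C + card D = card (C \<union> D) + 1"
    using card_Un_Int [OF fin] by simp
  moreover have "0 < card C" "0 < card D"
    using u fin by (auto simp: card_gt_0_iff)
  moreover have "rank u = card C - 1" "rank v = card (C \<union> D) - 1"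
    using rank_eq_card [of u C] rank_eq_card [of v "C \<union> D"] C CD uv
    by (simp_all add: maxchain_to_def)
  ultimately show ?thesis by linarith
qed

lemma rank_strict_mono:
  assumes "u \<in> P" "v \<in> P" "u < v"
  shows "rank u < rank v"
proof -
  obtain D where D: "pred_on.maxchain (P \<inter> {u..v}) (\<le>) D"
    using pred_on.Hausdorff by blast
  have "finite D"
    using maxchain_subset [OF D] by (rule finite_subset) simp
  moreover have "{u, v} \<subseteq> D"
    using maxchain_interval_endpoints [OF D] assms by simp
  ultimately have "card {u, v} \<le> card D"
    by (rule card_mono)
  then show ?thesis
    using rank_add_interval [OF D] assms by simp
qed

lemma rank_mono: "u \<in> P \<Longrightarrow> v \<in> P \<Longrightarrow> u \<le> v \<Longrightarrow> rank u \<le> rank v"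
  using rank_strict_mono [of u v] by (cases "u = v") (auto simp: less_le)

lemma rank_zero [simp]: "rank \<zero> = 0"
proof -
  obtain C where C: "maxchain_to P \<zero> C"
    using pred_on.Hausdorff unfolding maxchain_to_def by blast
  then have "C \<subseteq> P \<inter> {\<zero>..\<zero>}"
    unfolding maxchain_to_def by (rule maxchain_subset)
  then have "C \<subseteq> {\<zero>}"
    by auto
  then have "card C \<le> card {\<zero>}"
    by (intro card_mono) auto
  then show ?thesis
    using rank_eq_card [OF _ C] by simp
qed

lemma rank_le_one: "u \<in> P \<Longrightarrow> rank u \<le> rank \<one>"
  by (simp add: rank_mono le_one)

lemma bottom_interval:
  assumes "u \<in> P" "u \<le> w"
  shows "bottom (P \<inter> {u..w}) = u"
  unfolding bottom_def by (rule Least_equality) (use assms in auto)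

lemma rk_interval:
  assumes "u \<in> P" "v \<in> P \<inter> {u..w}"
  shows "rk (P \<inter> {u..w}) v = rank v - rank u"
proof -
  have "bottom (P \<inter> {u..w}) = u"
    using assms by (intro bottom_interval) auto
  moreover have "P \<inter> {u..w} \<inter> {u..v} = P \<inter> {u..v}"
    using assms by auto
  ultimately have max: "maxchain_to (P \<inter> {u..w}) v C \<longleftrightarrow> pred_on.maxchain (P \<inter> {u..v}) (\<le>) C" for C
    by (simp add: maxchain_to_def)
  obtain D where D: "pred_on.maxchain (P \<inter> {u..v}) (\<le>) D"
    using pred_on.Hausdorff by blast
  have card: "card C - 1 = rank v - rank u" if "pred_on.maxchain (P \<inter> {u..v}) (\<le>) C" for C
    using rank_add_interval [OF that] assms by simp
  show ?thesis
    unfolding rk_def [of "P \<inter> {u..w}"] max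
    by (rule the_equality) (use D card in metis)+
qed

lemma induct_from_top [consumes 1, case_names step]:
  assumes "u \<in> P"
    and step: "\<And>u. u \<in> P \<Longrightarrow> (\<And>v. v \<in> P \<Longrightarrow> u < v \<Longrightarrow> Q v) \<Longrightarrow> Q u"
  shows "Q u"
  using assms(1)
proof (induction "rank \<one> - rank u" arbitrary: u rule: less_induct)
  case less
  show ?case
  proof (rule step [OF less.prems])
    fix v
    assume v: "v \<in> P" "u < v"
    with less.prems have "rank \<one> - rank v < rank \<one> - rank u"
      using rank_strict_mono [of u v] rank_le_one [of v] by linarith
    then show "Q v"
      using less.hyps v by blast
  qed
qed

lemma sum_interval_swap:
  "(\<Sum>t\<in>P \<inter> {u..w}. \<Sum>x\<in>P \<inter> {t..w}. f t x) = (\<Sum>x\<in>P \<inter> {u..w}. \<Sum>t\<in>P \<inter> {u..x}. f t x)"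
proof -
  have "(\<Sum>t\<in>P \<inter> {u..w}. \<Sum>x\<in>P \<inter> {t..w}. f t x) =
      (\<Sum>t\<in>P \<inter> {u..w}. \<Sum>x | x \<in> P \<inter> {u..w} \<and> t \<le> x. f t x)"
    by (intro sum.cong) (auto intro: order_trans)
  also have "\<dots> = (\<Sum>x\<in>P \<inter> {u..w}. \<Sum>t | t \<in> P \<inter> {u..w} \<and> t \<le> x. f t x)"
    by (rule sum.swap_restrict) auto
  also have "\<dots> = (\<Sum>x\<in>P \<inter> {u..w}. \<Sum>t\<in>P \<inter> {u..x}. f t x)"
    by (intro sum.cong) (auto intro: order_trans)
  finally show ?thesis .
qed

lemma sum_up_set_swap:
  "(\<Sum>t\<in>P \<inter> {u..}. \<Sum>x\<in>P \<inter> {t..}. f t x) = (\<Sum>x\<in>P \<inter> {u..}. \<Sum>t\<in>P \<inter> {u..x}. f t x)"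
proof -
  have "P \<inter> {x..} = P \<inter> {x..\<one>}" for x
    using le_one by auto
  then show ?thesis
    using sum_interval_swap by simp
qed

lemma mobius_interval:
  assumes "u \<in> P" "v \<in> P \<inter> {u..w}"
  shows "mobius (P \<inter> {u..w}) u v = mobius P u v"
  using assms(2)
proof (induction "rank v" arbitrary: v rule: less_induct)
  case less
  have "(\<Sum>x | x \<in> P \<inter> {u..w} \<and> u \<le> x \<and> x < v. mobius (P \<inter> {u..w}) u x) =
      (\<Sum>x | x \<in> P \<and> u \<le> x \<and> x < v. mobius P u x)"
    using less.prems by (intro sum.cong less.hyps) (auto intro: rank_strict_mono)
  then show ?case
    by (simp add: mobius.simps [of _ u v])
qed

lemma sum_mobius_right:
  assumes "u \<in> P" "w \<in> P" "u \<le> w"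
  shows "(\<Sum>v\<in>P \<inter> {u..w}. mobius P u v) = of_bool (u = w)"
proof (cases "u = w")
  case True
  then have "P \<inter> {u..w} = {u}" using assms by auto
  with True show ?thesis by (simp add: mobius.simps)
next
  case False
  have "P \<inter> {u..w} = insert w {v. v \<in> P \<and> u \<le> v \<and> v < w}"
    using assms by auto
  moreover have "finite {v. v \<in> P \<and> u \<le> v \<and> v < w}"
    by simp
  ultimately show ?thesis
    using False assms by (simp add: mobius.simps [of P u w])
qed

text \<open>
  The defining recursion says that the Moebius function is a left inverse of the zeta function. This
  is the other side: convolving the asserted sums with the Moebius function on the left returns the
  Moebius function, and the convolution is unitriangular.
\<close>

lemma sum_mobius_left:
  assumes "u \<in> P" "w \<in> P" "u \<le> w"
  shows "(\<Sum>v\<in>P \<inter> {u..w}. mobius P v w) = of_bool (u = w)"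
  using assms(1,3)
proof (induction u rule: induct_from_top)
  case (step u)
  let ?g = "\<lambda>t. \<Sum>x\<in>P \<inter> {t..w}. mobius P x w"
  have "(\<Sum>t\<in>P \<inter> {u..w}. mobius P u t * ?g t) =
      (\<Sum>x\<in>P \<inter> {u..w}. (\<Sum>t\<in>P \<inter> {u..x}. mobius P u t) * mobius P x w)"
    by (simp add: sum_distrib_left sum_distrib_right sum_interval_swap)
  also have "\<dots> = (\<Sum>x\<in>P \<inter> {u..w}. if x = u then mobius P x w else 0)"
    using step.hyps by (intro sum.cong) (auto simp: sum_mobius_right)
  also have "\<dots> = mobius P u w"
    using step by simp
  finally have conv: "(\<Sum>t\<in>P \<inter> {u..w}. mobius P u t * ?g t) = mobius P u w" .
  have split: "P \<inter> {u..w} = insert u (P \<inter> {u<..w})"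
    using step by auto
  have "(\<Sum>t\<in>P \<inter> {u<..w}. mobius P u t * ?g t) =
      (\<Sum>t\<in>P \<inter> {u<..w}. if t = w then mobius P u t else 0)"
    using step.IH by (intro sum.cong) auto
  also have "\<dots> = (if u < w then mobius P u w else 0)"
    using assms by simp
  finally have "mobius P u u * ?g u = mobius P u w - (if u < w then mobius P u w else 0)"
    using conv by (subst (asm) split) simp
  moreover have "mobius P v v = 1" for v
    by (simp add: mobius.simps)
  ultimately show ?case
    using step.prems by (auto split: if_splits)
qed

lemma Poin_interval:
  assumes "u \<in> P" "u \<le> w"
  shows "Poin (P \<inter> {u..w}) =
    (\<Sum>v\<in>P \<inter> {u..w}. of_int (mobius P u v) * (- var_y) ^ (rank v - rank u))"
  unfolding Poin_def bottom_interval [OF assms]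
  using assms by (intro sum.cong) (simp_all add: mobius_interval rk_interval)

text \<open>
  In the incidence algebra, \<open>Poin\<close> is the Moebius function with the entry at \<open>(u, v)\<close> multiplied by
  \<open>(- y)^(rk v - rk u)\<close>, times the zeta function. The first factor is inverse to
  \<open>(- y)^(rk v - rk u)\<close>, because ranks add along intervals.
\<close>

lemma sum_power_Poin:
  assumes "u \<in> P" "w \<in> P" "u \<le> w"
  shows "(\<Sum>x\<in>P \<inter> {u..w}. (- var_y) ^ (rank x - rank u) * Poin (P \<inter> {x..w})) = 1"
proof -
  have "(\<Sum>x\<in>P \<inter> {u..w}. (- var_y) ^ (rank x - rank u) * Poin (P \<inter> {x..w})) =
      (\<Sum>x\<in>P \<inter> {u..w}. \<Sum>v\<in>P \<inter> {x..w}. (- var_y) ^ (rank v - rank u) * of_int (mobius P x v))"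
  proof (intro sum.cong refl)
    fix x
    assume x: "x \<in> P \<inter> {u..w}"
    have "(- var_y) ^ (rank x - rank u) * (- var_y) ^ (rank v - rank x) = (- var_y) ^ (rank v - rank u)"
      if "v \<in> P \<inter> {x..w}" for v
    proof -
      have "rank u \<le> rank x" "rank x \<le> rank v"
        using x that assms by (auto intro: rank_mono)
      then show ?thesis
        by (simp flip: power_add)
    qed
    then show "(- var_y) ^ (rank x - rank u) * Poin (P \<inter> {x..w}) =
        (\<Sum>v\<in>P \<inter> {x..w}. (- var_y) ^ (rank v - rank u) * of_int (mobius P x v))"
      using x by (simp add: Poin_interval sum_distrib_left mult.commute mult.left_commute)
  qed
  also have "\<dots> = (\<Sum>v\<in>P \<inter> {u..w}. (- var_y) ^ (rank v - rank u) *
      of_int (\<Sum>x\<in>P \<inter> {u..v}. mobius P x v))"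
    by (simp add: sum_interval_swap sum_distrib_left)
  also have "\<dots> = (\<Sum>v\<in>P \<inter> {u..w}. if v = u then 1 else 0)"
    using assms by (intro sum.cong) (auto simp: sum_mobius_left)
  also have "\<dots> = 1"
    using assms by simp
  finally show ?thesis .
qed

end

section \<open>Sums over chains\<close>

text \<open>
  The part of the word \<open>wt\<close> at the positions from \<open>i\<close> to \<open>j - 1\<close>, which makes it possible to cut a
  word at the ranks of the elements of a chain.
\<close>

definition wt_segment :: "nat \<Rightarrow> nat \<Rightarrow> nat set \<Rightarrow> 'c::ring_1 ab_poly" where
  "wt_segment i j S = prod_list (map (\<lambda>k. if k \<in> S then var_b else var_e) [i..<j])"

lemma wt_segment_split:
  "i \<le> j \<Longrightarrow> j \<le> l \<Longrightarrow> wt_segment i l S = wt_segment i j S * wt_segment j l S"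
  using upt_add_eq_append [of i j "l - j"] by (simp add: wt_segment_def)

lemma wt_segment_disjoint:
  assumes "S \<inter> {i..<j} = {}"
  shows "wt_segment i j S = (var_e :: 'c::ring_1 ab_poly) ^ (j - i)"
proof -
  have "map (\<lambda>k. if k \<in> S then var_b else var_e) [i..<j] = replicate (j - i) (var_e :: 'c ab_poly)"
    using assms by (auto simp: list_eq_iff_nth_eq)
  then show ?thesis
    by (simp only: wt_segment_def prod_list_replicate)
qed

lemma wt_segment_insert:
  assumes "i < j" "j \<le> l" "S \<subseteq> {j..}"
  shows "wt_segment i l (insert i S) =
    var_b * (var_e ^ (j - i - 1) * (wt_segment j l S :: 'c::ring_1 ab_poly))"
proof -
  have "wt_segment i (Suc i) (insert i S) = (var_b :: 'c ab_poly)"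
    by (simp add: wt_segment_def)
  moreover have "wt_segment (Suc i) j (insert i S) = (var_e :: 'c ab_poly) ^ (j - i - 1)"
    using assms by (subst wt_segment_disjoint) auto
  moreover have "wt_segment j l (insert i S) = (wt_segment j l S :: 'c ab_poly)"
    using assms unfolding wt_segment_def by (intro arg_cong [of _ _ prod_list] map_cong) auto
  ultimately show ?thesis
    using assms by (simp add: wt_segment_split [of i "Suc i" l] wt_segment_split [of "Suc i" j l])
qed

context fgb_poset
begin

definition chains_from :: "'a \<Rightarrow> 'a set set" where
  "chains_from u = {C \<in> top_chains P. u \<in> C \<and> C \<subseteq> {u..}}"

definition chain_weight :: "('a \<Rightarrow> 'a \<Rightarrow> 'c::comm_ring_1) \<Rightarrow> 'a set \<Rightarrow> 'c" where
  "chain_weight m C = (\<Prod>x\<in>C - {\<one>}. m x (next_in C x))"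

text \<open>
  A common generalization of the two indices: the weight of a step of a chain is \<open>1\<close> for the ab-index
  and a Poincare polynomial for the extended ab-index.
\<close>

definition weighted_ab_index :: "('a \<Rightarrow> 'a \<Rightarrow> 'c::comm_ring_1) \<Rightarrow> 'c ab_poly" where
  "weighted_ab_index m = (\<Sum>C\<in>top_chains P. const (chain_weight m C) * wt_chain P C)"

definition chain_sum :: "('a \<Rightarrow> 'a \<Rightarrow> 'c::comm_ring_1) \<Rightarrow> 'a \<Rightarrow> 'c ab_poly" where
  "chain_sum m u = (\<Sum>C\<in>chains_from u.
     const (chain_weight m C) * wt_segment (rank u) (rank \<one>) (rank ` (C - {\<one>})))"

text \<open>
  Apart from the top element, this is \<open>chain_sum\<close> without its initial letter \<open>b\<close>. It is stated as the
  sum over the second element of the chain, so that it vanishes at the top, where the equation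
  \<open>chain_sum_eq_tail\<close> needs it to.
\<close>

definition chain_tail :: "('a \<Rightarrow> 'a \<Rightarrow> 'c::comm_ring_1) \<Rightarrow> 'a \<Rightarrow> 'c ab_poly" where
  "chain_tail m u = (\<Sum>w\<in>P \<inter> {u<..}.
     const (m u w) * (var_e ^ (rank w - rank u - 1) * chain_sum m w))"

lemma top_chains_iff:
  "C \<in> top_chains P \<longleftrightarrow> C \<subseteq> P \<and> \<one> \<in> C \<and> (\<forall>x\<in>C. \<forall>z\<in>C. x \<le> z \<or> z \<le> x)"
  by (auto simp: top_chains_def chain_le_iff)

lemma finite_chain: "C \<in> top_chains P \<Longrightarrow> finite C"
  using finite_subset [OF _ finite_P] by (auto simp: top_chains_iff)

lemma finite_top_chains [simp]: "finite (top_chains P)"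
  by (rule finite_subset [of _ "Pow P"]) (auto simp: top_chains_iff)

lemma finite_chains_from [simp]: "finite (chains_from u)"
  by (simp add: chains_from_def)

lemma chains_from_disjoint: "u \<noteq> v \<Longrightarrow> chains_from u \<inter> chains_from v = {}"
proof -
  have "u = v" if "C \<in> chains_from u" "C \<in> chains_from v" for C
    using that by (intro antisym) (auto simp: chains_from_def)
  then show "u \<noteq> v \<Longrightarrow> chains_from u \<inter> chains_from v = {}"
    by blast
qed

lemma top_chains_eq_UN: "top_chains P = (\<Union>u\<in>P. chains_from u)"
proof (intro equalityI subsetI)
  fix C
  assume C: "C \<in> top_chains P"
  then obtain u where "u \<in> C" "\<And>x. x \<in> C \<Longrightarrow> u \<le> x"
    using finite_chain_least [OF finite_chain [OF C]] unfolding top_chains_iff by blast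
  with C show "C \<in> (\<Union>u\<in>P. chains_from u)"
    by (auto simp: chains_from_def top_chains_iff)
qed (auto simp: chains_from_def)

lemma chains_from_one: "chains_from \<one> = {{\<one>}}"
proof -
  have "P \<inter> {\<one>..} = {\<one>}"
    by (auto intro: antisym le_one)
  then show ?thesis
    by (auto simp: chains_from_def top_chains_iff)
qed

text \<open>
  A chain from \<open>u\<close> that is not only the top element is \<open>u\<close> followed by a chain from its second
  element.
\<close>

lemma chains_from_eq_UN:
  assumes "u \<in> P" "u \<noteq> \<one>"
  shows "chains_from u = (\<Union>w\<in>P \<inter> {u<..}. insert u ` chains_from w)"
proof (intro equalityI subsetI)
  fix C
  assume "C \<in> chains_from u"
  then have C: "C \<in> top_chains P" "u \<in> C" "C \<subseteq> {u..}"
    by (auto simp: chains_from_def)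
  let ?D = "C - {u}"
  have D: "?D \<in> top_chains P"
    using C assms by (auto simp: top_chains_iff)
  then obtain w where w: "w \<in> ?D" "\<And>x. x \<in> ?D \<Longrightarrow> w \<le> x"
    using finite_chain_least [OF finite_chain [OF D]] unfolding top_chains_iff by blast
  have "?D \<in> chains_from w"
    using D w by (auto simp: chains_from_def)
  moreover have "w \<in> P \<inter> {u<..}"
    using w C by (auto simp: top_chains_iff less_le)
  moreover have "C = insert u ?D"
    using C by auto
  ultimately show "C \<in> (\<Union>w\<in>P \<inter> {u<..}. insert u ` chains_from w)"
    by blast
next
  fix C
  assume "C \<in> (\<Union>w\<in>P \<inter> {u<..}. insert u ` chains_from w)"
  then obtain w D where w: "w \<in> P" "u < w" and D: "D \<in> top_chains P" "D \<subseteq> {w..}" "C = insert u D"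
    by (auto simp: chains_from_def)
  then have "u < x" if "x \<in> D" for x
    using that by (auto intro: less_le_trans)
  then show "C \<in> chains_from u"
    using D assms unfolding chains_from_def top_chains_iff by (auto simp: less_imp_le)
qed

lemma chain_weight_insert:
  assumes D: "D \<in> chains_from w" and uw: "u < w" "w \<in> P"
  shows "chain_weight m (insert u D) = m u w * chain_weight m D"
proof -
  have D': "D \<in> top_chains P" "w \<in> D" "D \<subseteq> {w..}"
    using D by (auto simp: chains_from_def)
  have "u \<noteq> \<one>"
    using uw le_one [of w] by auto
  have gt: "u < x" if "x \<in> D" for x
    using that D' uw by (auto intro: less_le_trans)
  then have "u \<notin> D" by auto
  have "next_in (insert u D) u = w"
    unfolding next_in_def by (rule Least_equality) (use D' uw in auto)
  moreover have "next_in (insert u D) x = next_in D x" if "x \<in> D" for x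
  proof -
    have "z \<in> insert u D \<and> x < z \<longleftrightarrow> z \<in> D \<and> x < z" for z
      using gt [OF that] by auto
    then show ?thesis
      by (simp only: next_in_def)
  qed
  moreover have "insert u D - {\<one>} = insert u (D - {\<one>})"
    using \<open>u \<noteq> \<one>\<close> by auto
  ultimately show ?thesis
    using \<open>u \<notin> D\<close> finite_chain [OF D'(1)] unfolding chain_weight_def by simp
qed

lemma chain_sum_one: "chain_sum m \<one> = 1"
  by (simp add: chain_sum_def chains_from_one chain_weight_def wt_segment_def)

text \<open>
  Prepending \<open>u\<close> to a chain from \<open>w\<close> multiplies its weight by \<open>m u w\<close> and its word by \<open>b\<close>, for the
  rank of \<open>u\<close>, followed by \<open>a - b\<close> for each rank strictly between \<open>u\<close> and \<open>w\<close>.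
\<close>

lemma chain_sum_recursion:
  fixes m :: "'a \<Rightarrow> 'a \<Rightarrow> 'c::comm_ring_1"
  assumes u: "u \<in> P" "u \<noteq> \<one>"
  shows "chain_sum m u = var_b * chain_tail m u"
proof -
  let ?f = "\<lambda>C. const (chain_weight m C) * wt_segment (rank u) (rank \<one>) (rank ` (C - {\<one>}))"
  have step: "(\<Sum>C\<in>insert u ` chains_from w. ?f C) =
      var_b * (const (m u w) * (var_e ^ (rank w - rank u - 1) * chain_sum m w))"
    if w: "w \<in> P" "u < w" for w
  proof -
    have inj: "inj_on (insert u) (chains_from w)"
    proof (rule inj_onI)
      fix C D
      assume "C \<in> chains_from w" "D \<in> chains_from w" "insert u C = insert u D"
      moreover have "u \<notin> E" if "E \<in> chains_from w" for E
        using that w by (auto simp: chains_from_def)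
      ultimately show "C = D" by (metis insert_ident)
    qed
    have summand: "?f (insert u D) = var_b * (const (m u w) * (var_e ^ (rank w - rank u - 1) *
        (const (chain_weight m D) * wt_segment (rank w) (rank \<one>) (rank ` (D - {\<one>})))))"
      if D: "D \<in> chains_from w" for D
    proof -
      have "insert u D - {\<one>} = insert u (D - {\<one>})"
        using u by auto
      moreover have "rank ` (D - {\<one>}) \<subseteq> {rank w..}"
        using D w by (auto simp: chains_from_def top_chains_iff subset_iff intro: rank_mono)
      ultimately have "wt_segment (rank u) (rank \<one>) (rank ` (insert u D - {\<one>})) =
          var_b * (var_e ^ (rank w - rank u - 1) * wt_segment (rank w) (rank \<one>) (rank ` (D - {\<one>})) :: 'c ab_poly)"
        using wt_segment_insert [of "rank u" "rank w" "rank \<one>" "rank ` (D - {\<one>})"] u w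
        by (simp add: rank_strict_mono rank_le_one)
      then show ?thesis
        using chain_weight_insert [OF D w(2,1), of m]
        by (simp add: const_mult const_left_commute [of var_b] const_left_commute [of "var_e ^ k" for k] mult.assoc)
    qed
    have "(\<Sum>C\<in>insert u ` chains_from w. ?f C) = (\<Sum>D\<in>chains_from w. ?f (insert u D))"
      by (simp only: sum.reindex [OF inj] o_def)
    also have "\<dots> = var_b * (const (m u w) * (var_e ^ (rank w - rank u - 1) * chain_sum m w))"
      unfolding chain_sum_def sum_distrib_left by (rule sum.cong) (simp_all only: summand)
    finally show ?thesis .
  qed
  have disj: "insert u ` chains_from v \<inter> insert u ` chains_from w = {}"
    if "v \<in> P \<inter> {u<..}" "w \<in> P \<inter> {u<..}" "v \<noteq> w" for v w
  proof -
    have "insert u C \<noteq> insert u D" if "C \<in> chains_from v" "D \<in> chains_from w" for C D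
    proof
      assume eq: "insert u C = insert u D"
      have "u \<notin> C" "u \<notin> D"
        using that \<open>v \<in> P \<inter> {u<..}\<close> \<open>w \<in> P \<inter> {u<..}\<close> by (auto simp: chains_from_def)
      with eq have "C = D" by (metis insert_ident)
      with that chains_from_disjoint [OF \<open>v \<noteq> w\<close>] show False by auto
    qed
    then show ?thesis by auto
  qed
  have "chain_sum m u = (\<Sum>w\<in>P \<inter> {u<..}. \<Sum>C\<in>insert u ` chains_from w. ?f C)"
    unfolding chain_sum_def chains_from_eq_UN [OF u]
    by (rule sum.UNION_disjoint) (use disj in auto)
  also have "\<dots> = var_b * chain_tail m u"
    unfolding chain_tail_def sum_distrib_left by (rule sum.cong) (auto simp only: step Int_iff greaterThan_iff)
  finally show ?thesis .
qed

lemma chain_sum_eq_tail: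
  assumes "u \<in> P"
  shows "chain_sum m u = of_bool (u = \<one>) + var_b * chain_tail m u"
proof (cases "u = \<one>")
  case True
  then have "P \<inter> {u<..} = {}"
    using le_one by (auto simp: less_le_not_le)
  with True show ?thesis
    by (simp add: chain_sum_one chain_tail_def)
qed (use assms chain_sum_recursion in auto)

lemma weighted_ab_index_eq:
  fixes m :: "'a \<Rightarrow> 'a \<Rightarrow> 'c::comm_ring_1"
  shows "weighted_ab_index m = (\<Sum>u\<in>P. var_e ^ rank u * chain_sum m u)"
proof -
  have "weighted_ab_index m =
      (\<Sum>u\<in>P. \<Sum>C\<in>chains_from u. const (chain_weight m C) * wt_chain P C)"
    unfolding weighted_ab_index_def top_chains_eq_UN
    by (rule sum.UNION_disjoint) (auto simp: chains_from_disjoint)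
  also have "\<dots> = (\<Sum>u\<in>P. var_e ^ rank u * chain_sum m u)"
  proof (rule sum.cong [OF refl])
    fix u
    assume u: "u \<in> P"
    have "wt_chain P C = var_e ^ rank u * (wt_segment (rank u) (rank \<one>) (rank ` (C - {\<one>})) :: 'c ab_poly)"
      if C: "C \<in> chains_from u" for C
    proof -
      have "rank u \<le> rank x" if "x \<in> C" for x
        using C u that by (auto simp: chains_from_def top_chains_iff intro!: rank_mono)
      then have "rank ` (C - {\<one>}) \<inter> {0..<rank u} = {}"
        by force
      moreover have "wt_chain P C = (wt_segment 0 (rank \<one>) (rank ` (C - {\<one>})) :: 'c ab_poly)"
        by (simp add: wt_chain_def wt_def wt_segment_def poset_rank_def)
      ultimately show ?thesis
        using u by (simp add: wt_segment_split [of 0 "rank u" "rank \<one>"] rank_le_one wt_segment_disjoint)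
    qed
    then show "(\<Sum>C\<in>chains_from u. const (chain_weight m C) * wt_chain P C) =
        var_e ^ rank u * chain_sum m u"
      unfolding chain_sum_def sum_distrib_left
      by (intro sum.cong) (simp_all add: const_left_commute [of "var_e ^ k" for k])
  qed
  finally show ?thesis .
qed

text \<open>
  Chains that avoid the bottom element have a word that starts with \<open>a - b\<close>, and
  \<open>iota ((a - b) f) = f - f = 0\<close>.
\<close>

lemma iota_weighted_ab_index:
  assumes "poset_rank P \<ge> 1"
  shows "iota (weighted_ab_index m) = chain_tail m \<zero>"
proof -
  have "\<zero> \<noteq> \<one>"
    using assms by (metis poset_rank_def rank_zero not_one_le_zero)
  have "iota (var_e ^ rank u * chain_sum m u) = (if u = \<zero> then chain_tail m \<zero> else 0)"
    if "u \<in> P" for u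
  proof (cases "u = \<zero>")
    case True
    then show ?thesis
      using \<open>\<zero> \<noteq> \<one>\<close> by (simp add: chain_sum_recursion)
  next
    case False
    then have "rank \<zero> < rank u"
      using that zero_le by (intro rank_strict_mono) (auto simp: less_le)
    then obtain k where "rank u = Suc k"
      using gr0_implies_Suc by auto
    then have "var_e ^ rank u * chain_sum m u =
        var_a * (var_e ^ k * chain_sum m u) - var_b * (var_e ^ k * chain_sum m u)"
      by (simp add: left_diff_distrib mult.assoc)
    then show ?thesis
      using False by (simp add: iota_diff)
  qed
  then show ?thesis
    by (simp add: weighted_ab_index_eq iota_sum)
qed

section \<open>The balance equation\<close>

text \<open>
  In the incidence algebra with noncommutative coefficients, this reads
  \<open>Z (\<delta> + b E) = Z' (\<delta> + a E)\<close>, where \<open>Z\<close> has the entries \<open>(a - b)^(rk w - rk u)\<close> and \<open>Z'\<close> the entries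
  \<open>(- y)^(rk w - rk u) (a - b)^(rk w - rk u)\<close>, and where \<open>\<delta>\<close> is the indicator vector of the top.
\<close>

definition balanced :: "('a \<Rightarrow> int poly ab_poly) \<Rightarrow> bool" where
  "balanced E \<longleftrightarrow> (\<forall>u\<in>P.
     (\<Sum>w\<in>P \<inter> {u..}. var_e ^ (rank w - rank u) * (of_bool (w = \<one>) + var_b * E w)) =
     (\<Sum>w\<in>P \<inter> {u..}. const ((- var_y) ^ (rank w - rank u)) *
        (var_e ^ (rank w - rank u) * (of_bool (w = \<one>) + var_a * E w))))"

lemma up_set_split: "u \<in> P \<Longrightarrow> P \<inter> {u..} = insert u (P \<inter> {u<..})"
  by auto

text \<open>
  The system is triangular with the diagonal entry \<open>a - b\<close>, which can be cancelled.
\<close>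

lemma balanced_unique:
  assumes E: "balanced E" and F: "balanced F" and "u \<in> P"
  shows "E u = F u"
  using \<open>u \<in> P\<close>
proof (induction u rule: induct_from_top)
  case (step u)
  let ?b = "\<lambda>E. \<Sum>w\<in>P \<inter> {u<..}. var_e ^ (rank w - rank u) * (of_bool (w = \<one>) + var_b * E w)"
  let ?a = "\<lambda>E. \<Sum>w\<in>P \<inter> {u<..}. const ((- var_y) ^ (rank w - rank u)) *
        (var_e ^ (rank w - rank u) * (of_bool (w = \<one>) + var_a * E w))"
  have eq: "var_b * E u + ?b E = var_a * E u + ?a E" if "balanced E" for E
    using that step.hyps unfolding balanced_def by (force simp: up_set_split)
  have tails: "?b E = ?b F" "?a E = ?a F"
    using step.IH by (auto intro!: sum.cong)
  have rearrange: "p' - p = q - q'" if "p + q = p' + q'" for p q p' q' :: "int poly ab_poly"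
    using that by (simp add: algebra_simps)
  have "var_a * E u - var_b * E u = ?b E - ?a E" "var_a * F u - var_b * F u = ?b F - ?a F"
    by (rule rearrange [OF eq [OF E]], rule rearrange [OF eq [OF F]])
  then have "var_a * E u - var_b * E u = var_a * F u - var_b * F u"
    by (simp only: tails)
  then have "var_a * (E u - F u) = var_b * (E u - F u)"
    by (simp add: algebra_simps)
  then show ?case
    using var_a_mult_eq_var_b_mult by fastforce
qed

text \<open>
  The recursion for \<open>chain_tail\<close> expresses \<open>\<delta> + a E\<close> by \<open>\<delta> + b E\<close> with Poincare polynomials as
  coefficients; \<open>sum_power_Poin\<close> inverts this relation.
\<close>

lemma balanced_Poincare: "balanced (chain_tail (\<lambda>x w. Poin (P \<inter> {x..w})))"
  unfolding balanced_def
proof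
  fix u
  assume u: "u \<in> P"
  define m where "m = (\<lambda>x w. Poin (P \<inter> {x..w}))"
  define E where "E = chain_tail m"
  define G where "G = (\<lambda>w. of_bool (w = \<one>) + var_b * E w)"
  \<comment> \<open>As \<open>a = b + (a - b)\<close>, the left side is the term \<open>w = x\<close> plus \<open>(a - b) E(x)\<close>, which the recursion expands.\<close>
  have a_sum: "of_bool (x = \<one>) + var_a * E x =
      (\<Sum>w\<in>P \<inter> {x..}. const (m x w) * (var_e ^ (rank w - rank x) * G w))"
    if x: "x \<in> P" for x
  proof -
    have "P \<inter> {x..x} = {x}"
      using x by auto
    then have "m x x = 1"
      using sum_power_Poin [of x x] x by (simp add: m_def)
    moreover have "var_e * E x =
        (\<Sum>w\<in>P \<inter> {x<..}. const (m x w) * (var_e ^ (rank w - rank x) * G w))"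
      unfolding E_def chain_tail_def [of m x] sum_distrib_left
    proof (rule sum.cong [OF refl])
      fix w
      assume w: "w \<in> P \<inter> {x<..}"
      define k where "k = rank w - rank x - 1"
      have k: "rank w - rank x = Suc k"
        using rank_strict_mono [of x w] x w by (simp add: k_def)
      moreover have "chain_sum m w = G w"
        using w by (simp add: G_def E_def chain_sum_eq_tail)
      ultimately show "var_e * (const (m x w) * (var_e ^ (rank w - rank x - 1) * chain_sum m w)) =
          const (m x w) * (var_e ^ (rank w - rank x) * G w)"
        unfolding k_def [symmetric] unfolding k
        by (simp only: const_left_commute [of var_e] power_Suc mult.assoc)
    qed
    moreover have "of_bool (x = \<one>) + var_a * E x = G x + var_e * E x"
      by (simp add: G_def left_diff_distrib)
    ultimately show ?thesis
      using x by (simp add: up_set_split)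
  qed
  have "(\<Sum>x\<in>P \<inter> {u..}. const ((- var_y) ^ (rank x - rank u)) *
        (var_e ^ (rank x - rank u) * (of_bool (x = \<one>) + var_a * E x))) =
      (\<Sum>x\<in>P \<inter> {u..}. \<Sum>w\<in>P \<inter> {x..}.
        const ((- var_y) ^ (rank x - rank u) * m x w) * (var_e ^ (rank w - rank u) * G w))"
  proof (rule sum.cong [OF refl])
    fix x
    assume x: "x \<in> P \<inter> {u..}"
    have "const ((- var_y) ^ (rank x - rank u)) *
          (var_e ^ (rank x - rank u) * (const (m x w) * (var_e ^ (rank w - rank x) * G w))) =
        const ((- var_y) ^ (rank x - rank u) * m x w) * (var_e ^ (rank w - rank u) * G w)"
      if w: "w \<in> P \<inter> {x..}" for w
    proof -
      have "rank u \<le> rank x" "rank x \<le> rank w"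
        using u x w by (auto intro: rank_mono)
      then have "var_e ^ (rank w - rank u) = var_e ^ (rank x - rank u) * (var_e :: int poly ab_poly) ^ (rank w - rank x)"
        by (simp flip: power_add)
      then show ?thesis
        by (simp only: const_mult const_left_commute [of "var_e ^ k" for k] mult.assoc)
    qed
    then show "const ((- var_y) ^ (rank x - rank u)) *
        (var_e ^ (rank x - rank u) * (of_bool (x = \<one>) + var_a * E x)) =
        (\<Sum>w\<in>P \<inter> {x..}.
          const ((- var_y) ^ (rank x - rank u) * m x w) * (var_e ^ (rank w - rank u) * G w))"
      unfolding a_sum [OF IntD1 [OF x]] sum_distrib_left by (rule sum.cong [OF refl])
  qed
  also have "\<dots> = (\<Sum>w\<in>P \<inter> {u..}.
      const (\<Sum>x\<in>P \<inter> {u..w}. (- var_y) ^ (rank x - rank u) * m x w) * (var_e ^ (rank w - rank u) * G w))"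
    by (simp only: sum_up_set_swap const_sum sum_distrib_right)
  also have "\<dots> = (\<Sum>w\<in>P \<inter> {u..}. var_e ^ (rank w - rank u) * G w)"
    using u by (intro sum.cong) (auto simp: m_def sum_power_Poin)
  finally show "(\<Sum>w\<in>P \<inter> {u..}. var_e ^ (rank w - rank u) *
        (of_bool (w = \<one>) + var_b * chain_tail (\<lambda>x w. Poin (P \<inter> {x..w})) w)) =
      (\<Sum>w\<in>P \<inter> {u..}. const ((- var_y) ^ (rank w - rank u)) * (var_e ^ (rank w - rank u) *
        (of_bool (w = \<one>) + var_a * chain_tail (\<lambda>x w. Poin (P \<inter> {x..w})) w)))"
    by (simp only: G_def E_def m_def)
qed

lemma omega_var_e_power_mult_chain_sum:
  fixes k :: nat
  defines "E \<equiv> \<lambda>u. (1 + y) * omega (chain_tail (\<lambda>_ _. 1) u)"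
  assumes "w \<in> P"
  shows "(1 + y) * omega (var_e ^ k * chain_sum (\<lambda>_ _. 1) w) =
    var_e ^ k * (of_bool (w = \<one>) + var_b * E w) +
    const (var_y * (- var_y) ^ k) * (var_e ^ k * (of_bool (w = \<one>) + var_a * E w))"
  using assms(2) by (simp only: chain_sum_eq_tail omega_var_e_power_mult E_def)

text \<open>
  Applying \<open>omega\<close> to the recursion for \<open>chain_tail\<close> and multiplying by \<open>(1 + y) (a - b)\<close> yields
  the terms of the balance equation with \<open>w > u\<close>. The left side \<open>(a - b) E(u)\<close> supplies the terms
  with \<open>w = u\<close>.
\<close>

lemma balanced_omega: "balanced (\<lambda>u. (1 + y) * omega (chain_tail (\<lambda>_ _. 1) u))"
  unfolding balanced_def
proof
  fix u
  assume u: "u \<in> P"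
  define E where "E = (\<lambda>u. (1 + y) * omega (chain_tail (\<lambda>_ _. 1) u))"
  let ?b = "\<lambda>w. var_e ^ (rank w - rank u) * (of_bool (w = \<one>) + var_b * E w)"
  let ?a = "\<lambda>w. const ((- var_y) ^ (rank w - rank u)) *
        (var_e ^ (rank w - rank u) * (of_bool (w = \<one>) + var_a * E w))"
  have "var_e * E u = (\<Sum>w\<in>P \<inter> {u<..}.
      var_e * ((1 + y) * omega (var_e ^ (rank w - rank u - 1) * chain_sum (\<lambda>_ _. 1) w)))"
    by (simp only: E_def chain_tail_def [of _ u] omega_sum sum_distrib_left const_1 mult_1_left)
  also have "\<dots> = (\<Sum>w\<in>P \<inter> {u<..}. ?b w - ?a w)"
  proof (rule sum.cong [OF refl])
    fix w
    assume w: "w \<in> P \<inter> {u<..}"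
    define k where "k = rank w - rank u - 1"
    have k: "rank w - rank u = Suc k"
      using rank_strict_mono [of u w] u w by (simp add: k_def)
    have "(1 + y) * omega (var_e ^ k * chain_sum (\<lambda>_ _. 1) w) =
        var_e ^ k * (of_bool (w = \<one>) + var_b * E w) +
        const (var_y * (- var_y) ^ k) * (var_e ^ k * (of_bool (w = \<one>) + var_a * E w))"
      using w by (simp only: Int_iff omega_var_e_power_mult_chain_sum E_def)
    then show "var_e * ((1 + y) * omega (var_e ^ (rank w - rank u - 1) * chain_sum (\<lambda>_ _. 1) w)) = ?b w - ?a w"
      unfolding k_def [symmetric] unfolding k
      by (simp only: distrib_left [of var_e] const_left_commute [of var_e] power_Suc mult.assoc)
         (simp add: const_minus mult.assoc)
  qed
  finally have "var_a * E u - var_b * E u = sum ?b (P \<inter> {u<..}) - sum ?a (P \<inter> {u<..})"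
    by (simp only: left_diff_distrib sum_subtractf)
  then have "sum ?b (P \<inter> {u..}) = sum ?a (P \<inter> {u..})"
    using u by (simp add: up_set_split algebra_simps)
  then show "(\<Sum>w\<in>P \<inter> {u..}. var_e ^ (rank w - rank u) *
        (of_bool (w = \<one>) + var_b * ((1 + y) * omega (chain_tail (\<lambda>_ _. 1) w)))) =
      (\<Sum>w\<in>P \<inter> {u..}. const ((- var_y) ^ (rank w - rank u)) * (var_e ^ (rank w - rank u) *
        (of_bool (w = \<one>) + var_a * ((1 + y) * omega (chain_tail (\<lambda>_ _. 1) w)))))"
    by (simp only: E_def)
qed

lemma chain_tail_Poincare:
  "u \<in> P \<Longrightarrow> chain_tail (\<lambda>x w. Poin (P \<inter> {x..w})) u = (1 + y) * omega (chain_tail (\<lambda>_ _. 1) u)"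
  using balanced_unique [OF balanced_Poincare balanced_omega] .

text \<open>
  The index is the sum on the left of the balance equation at the bottom element. Under \<open>omega\<close> it
  acquires \<open>y\<close> times the sum on the right.
\<close>

lemma weighted_ab_index_Poincare:
  "weighted_ab_index (\<lambda>x w. Poin (P \<inter> {x..w})) = omega (weighted_ab_index (\<lambda>_ _. 1))"
proof -
  define E where "E = (\<lambda>u. (1 + y) * omega (chain_tail (\<lambda>_ _. 1) u))"
  let ?b = "\<lambda>w. var_e ^ rank w * (of_bool (w = \<one>) + var_b * E w)"
  let ?a = "\<lambda>w. const ((- var_y) ^ rank w) * (var_e ^ rank w * (of_bool (w = \<one>) + var_a * E w))"
  have "P \<inter> {\<zero>..} = P"
    using zero_le by auto
  then have "sum ?b P = sum ?a P"
    using balanced_omega [unfolded balanced_def, rule_format, OF zero_in_P] by (simp add: E_def)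
  then have "const (1 + var_y) * sum ?b P = sum ?b P + y * sum ?a P"
    by (simp add: const_add distrib_right)
  also have "\<dots> = (\<Sum>w\<in>P. (1 + y) * omega (var_e ^ rank w * chain_sum (\<lambda>_ _. 1) w))"
    by (simp add: omega_var_e_power_mult_chain_sum E_def sum.distrib sum_distrib_left const_mult mult.assoc)
  also have "\<dots> = const (1 + var_y) * omega (weighted_ab_index (\<lambda>_ _. 1))"
    by (simp add: weighted_ab_index_eq omega_sum sum_distrib_left const_add)
  finally have "sum ?b P = omega (weighted_ab_index (\<lambda>_ _. 1))"
    by (rule const_mult_cancel) (simp add: var_y_def one_pCons)
  moreover have "weighted_ab_index (\<lambda>x w. Poin (P \<inter> {x..w})) = sum ?b P"
    by (simp add: weighted_ab_index_eq chain_sum_eq_tail chain_tail_Poincare E_def)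
  ultimately show ?thesis by simp
qed

lemma ex_ab_index_eq: "ex_ab_index P = weighted_ab_index (\<lambda>x w. Poin (P \<inter> {x..w}))"
  by (simp add: ex_ab_index_def weighted_ab_index_def Poin_chain_def chain_weight_def)

lemma ab_index_eq: "ab_index P = weighted_ab_index (\<lambda>_ _. 1)"
  by (simp add: ab_index_def weighted_ab_index_def chain_weight_def)

end

theorem theorem2p1:
  fixes P :: "'a::order set" and n :: nat
  assumes "finite_graded_bounded_poset P"
    and "poset_rank P = n"
    and "n \<ge> 1"
  shows "ex_ab_index P = omega (ab_index P) \<and>
         iota (ex_ab_index P) = const (1 + var_y) * omega (iota (ab_index P))"
proof -
  interpret fgb_poset P
    by standard (rule assms(1))
  show ?thesis
    unfolding ex_ab_index_eq ab_index_eq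
    using assms
    by (simp add: weighted_ab_index_Poincare [symmetric] iota_weighted_ab_index chain_tail_Poincare const_add)
qed

end
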